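(* Let $k\geq 1$ and let $G$ be a graph with $\delta(G)\geq k-1$. Suppose that $(d_{\times k}(G),d_{\times k,t}(G))\neq(2,1)$, i.e. either $d_{\times k}(G)\neq 2$, or $\delta(G)\geq k$ and $d_{\times k,t}(G)\neq 1$. Then $d_{\times k}^{r}(G)=d_{\times k}(G)$.
   Context: All graphs are finite, simple and undirected. For $G=(V,E)$ and $x\in V$, $N(x)$ is the open and $N[x]=N(x)\cup\{x\}$ the closed neighborhood. For $\delta(G)\geq k-1$: $S\subseteq V$ is a $k$-tuple dominating set if $|N[x]\cap S|\geq k$ for all $x\in V$; it is a $k$-tuple restrained dominating set if moreover every vertex of $V-S$ has at least $k$ neighbors in $V-S$. For $\delta(G)\geq k$: $S$ is a $k$-tuple total dominating set if $|N(x)\cap S|\geq k$ for all $x\in V$. The $k$-tuple domatic number $d_{\times k}(G)$ (resp. $k$-tuple restrained domatic number $d_{\times k}^{r}(G)$; $k$-tuple total domatic number $d_{\times k,t}(G)$, defined when $\delta(G)\geq k$) is the maximum number of classes of a partition of $V$ all of whose classes are $k$-tuple dominating sets (resp. $k$-tuple restrained dominating sets; $k$-tuple total dominating sets). *)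

theory Defs
  imports "Graph_Theory.Digraph" "HOL-Library.Disjoint_Sets"
begin

text \<open>
  A finite simple undirected graph is a value satisfying the locale predicate \<^const>\<open>graph\<close> of
  the AFP entry Graph_Theory: a finite symmetric digraph without loops and without parallel arcs,
  each edge $xy$ being represented by the two arcs $x \to y$ and $y \to x$.
\<close>

definition open_nbhd :: "('a, 'b) pre_digraph \<Rightarrow> 'a \<Rightarrow> 'a set" where
  "open_nbhd G x = {y. x \<rightarrow>\<^bsub>G\<^esub> y}"

definition closed_nbhd :: "('a, 'b) pre_digraph \<Rightarrow> 'a \<Rightarrow> 'a set" where
  "closed_nbhd G x = open_nbhd G x \<union> {x}"

text \<open>Unspecified, as usual, for the graph without vertices.\<close>
definition min_degree :: "('a, 'b) pre_digraph \<Rightarrow> nat" where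
  "min_degree G = Min ((\<lambda>x. card (open_nbhd G x)) ` verts G)"

definition tuple_dominating :: "nat \<Rightarrow> ('a, 'b) pre_digraph \<Rightarrow> 'a set \<Rightarrow> bool" where
  "tuple_dominating k G S \<longleftrightarrow>
     S \<subseteq> verts G \<and> (\<forall>x\<in>verts G. card (closed_nbhd G x \<inter> S) \<ge> k)"

definition tuple_restrained_dominating :: "nat \<Rightarrow> ('a, 'b) pre_digraph \<Rightarrow> 'a set \<Rightarrow> bool" where
  "tuple_restrained_dominating k G S \<longleftrightarrow>
     tuple_dominating k G S \<and>
     (\<forall>x\<in>verts G - S. card (open_nbhd G x \<inter> (verts G - S)) \<ge> k)"

definition tuple_total_dominating :: "nat \<Rightarrow> ('a, 'b) pre_digraph \<Rightarrow> 'a set \<Rightarrow> bool" where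
  "tuple_total_dominating k G S \<longleftrightarrow>
     S \<subseteq> verts G \<and> (\<forall>x\<in>verts G. card (open_nbhd G x \<inter> S) \<ge> k)"

text \<open>
  In a finite graph the maximum ranges over a finite set of numbers.  That set is nonempty for the
  first two numbers below when the minimum degree is at least $k - 1$, and for the third one when
  it is at least $k$: the partition whose only class is the whole vertex set qualifies.  Outside
  these ranges the numbers are undefined in the mathematics and their value here is meaningless.
\<close>
definition max_partition_size :: "'a set \<Rightarrow> ('a set \<Rightarrow> bool) \<Rightarrow> nat" where
  "max_partition_size V P = Max {card \<C> | \<C>. partition_on V \<C> \<and> (\<forall>S\<in>\<C>. P S)}"

definition tuple_domatic_number :: "nat \<Rightarrow> ('a, 'b) pre_digraph \<Rightarrow> nat" where
  "tuple_domatic_number k G = max_partition_size (verts G) (tuple_dominating k G)"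

definition tuple_restrained_domatic_number :: "nat \<Rightarrow> ('a, 'b) pre_digraph \<Rightarrow> nat" where
  "tuple_restrained_domatic_number k G =
     max_partition_size (verts G) (tuple_restrained_dominating k G)"

definition tuple_total_domatic_number :: "nat \<Rightarrow> ('a, 'b) pre_digraph \<Rightarrow> nat" where
  "tuple_total_domatic_number k G = max_partition_size (verts G) (tuple_total_dominating k G)"

end

(* Let x lie outside a class S of a partition into k-tuple dominating sets. A third class avoiding
   x supplies k neighbours of x outside S, so every partition whose number of classes is not 2 is
   already restrained. In a partition into k-tuple total dominating sets the class of x itself
   supplies these neighbours, which settles the case of two classes. *)
theory Submission
  imports Defs
begin

text \<open>Each such partition is an element of the finite set \<open>Pow (Pow V)\<close>. This
  makes the \<open>Max\<close> in \<open>max_partition_size\<close> meaningful.\<close>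

lemma finite_partition_sizes:
  assumes "finite V"
  shows "finite {card \<C> | \<C>. partition_on V \<C> \<and> (\<forall>S\<in>\<C>. P S)}"
proof -
  have "{card \<C> | \<C>. partition_on V \<C> \<and> (\<forall>S\<in>\<C>. P S)} \<subseteq> card ` Pow (Pow V)"
    by (auto simp: partition_on_def)
  then show ?thesis
    using assms by (meson finite_Pow_iff finite_imageI finite_subset)
qed

lemma card_le_max_partition_size:
  assumes "finite V" "partition_on V \<C>" "\<And>S. S \<in> \<C> \<Longrightarrow> P S"
  shows "card \<C> \<le> max_partition_size V P"
  unfolding max_partition_size_def
  using finite_partition_sizes[OF assms(1)] assms(2,3) by (intro Max_ge) auto

text \<open>\<open>P V\<close> guarantees that at least one admissible partition exists, so the
  maximum is a member of the set of sizes. Later proofs use this to pick an optimal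
  partition.\<close>

lemma max_partition_size_attained:
  assumes "finite V" "P V"
  obtains \<C> where "partition_on V \<C>" "\<And>S. S \<in> \<C> \<Longrightarrow> P S" "card \<C> = max_partition_size V P"
proof -
  let ?M = "{card \<C> | \<C>. partition_on V \<C> \<and> (\<forall>S\<in>\<C>. P S)}"
  have "\<exists>\<C>. partition_on V \<C> \<and> (\<forall>S\<in>\<C>. P S)"
  proof (cases "V = {}")
    \<comment> \<open>A partition has no empty class, so for empty \<open>V\<close> the witness is
      the empty partition instead of \<open>{V}\<close>.\<close>
    case True
    then show ?thesis by (intro exI[of _ "{}"]) (simp add: partition_on_def)
  next
    case False
    then show ?thesis using assms(2) by (intro exI[of _ "{V}"]) (simp add: partition_on_space)
  qed
  then have "?M \<noteq> {}" by blast
  then have "Max ?M \<in> ?M"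
    using finite_partition_sizes[OF assms(1)] by (rule Max_in[rotated])
  then show thesis
    using that unfolding max_partition_size_def by auto
qed

lemma max_partition_size_mono:
  assumes "finite V" "P V" "\<And>S. P S \<Longrightarrow> Q S"
  shows "max_partition_size V P \<le> max_partition_size V Q"
proof -
  obtain \<C> where \<C>: "partition_on V \<C>" "\<And>S. S \<in> \<C> \<Longrightarrow> P S" "card \<C> = max_partition_size V P"
    by (rule max_partition_size_attained[of V P, OF assms(1,2)]) blast
  then show ?thesis
    using card_le_max_partition_size[OF assms(1) \<C>(1), of Q] assms(3) by simp
qed

context graph
begin

lemma finite_open_nbhd: "finite (open_nbhd G x)"
  by (rule finite_subset[of _ "verts G"]) (auto simp: open_nbhd_def adj_in_verts)

lemma open_nbhd_subset_verts: "open_nbhd G x \<subseteq> verts G"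
  by (auto simp: open_nbhd_def adj_in_verts)

lemma card_closed_nbhd: "card (closed_nbhd G x) = Suc (card (open_nbhd G x))"
proof -
  have "x \<notin> open_nbhd G x" using adj_not_same by (auto simp: open_nbhd_def)
  then show ?thesis by (simp add: closed_nbhd_def finite_open_nbhd)
qed

lemma min_degree_le: "x \<in> verts G \<Longrightarrow> min_degree G \<le> card (open_nbhd G x)"
  by (simp add: min_degree_def)

lemma tuple_dominating_verts:
  assumes "min_degree G \<ge> k - 1"
  shows "tuple_dominating k G (verts G)"
  unfolding tuple_dominating_def
proof (intro conjI ballI)
  fix x assume x: "x \<in> verts G"
  have "closed_nbhd G x \<inter> verts G = closed_nbhd G x"
    using x open_nbhd_subset_verts by (auto simp: closed_nbhd_def)
  \<comment> \<open>The vertex itself adds one to its degree, which makes up for the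
    \<open>k - 1\<close>; truncation at \<open>k = 0\<close> does no harm.\<close>
  then show "k \<le> card (closed_nbhd G x \<inter> verts G)"
    using assms min_degree_le[OF x] by (simp add: card_closed_nbhd)
qed simp

text \<open>No vertex lies outside \<open>verts G\<close>, so the restraint condition is
  vacuous.\<close>

lemma tuple_restrained_dominating_verts:
  "min_degree G \<ge> k - 1 \<Longrightarrow> tuple_restrained_dominating k G (verts G)"
  by (simp add: tuple_restrained_dominating_def tuple_dominating_verts)

lemma tuple_total_dominating_verts:
  "min_degree G \<ge> k \<Longrightarrow> tuple_total_dominating k G (verts G)"
  unfolding tuple_total_dominating_def Int_absorb2[OF open_nbhd_subset_verts]
  using min_degree_le by (blast intro: order_trans)

lemma tuple_total_dominating_imp_dominating:
  assumes "tuple_total_dominating k G S"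
  shows "tuple_dominating k G S"
  unfolding tuple_dominating_def
proof (intro conjI ballI)
  fix x assume "x \<in> verts G"
  then have "k \<le> card (open_nbhd G x \<inter> S)"
    using assms by (simp add: tuple_total_dominating_def)
  also have "\<dots> \<le> card (closed_nbhd G x \<inter> S)"
    by (intro card_mono) (auto simp: closed_nbhd_def finite_open_nbhd)
  finally show "k \<le> card (closed_nbhd G x \<inter> S)" .
qed (use assms in \<open>simp add: tuple_total_dominating_def\<close>)

text \<open>Counting neighbours in a part of the complement bounds the count in the whole complement
  from below. In both applications \<open>T\<close> is a class of the partition, and it may vary
  with \<open>x\<close>.\<close>

lemma tuple_restrained_dominatingI:
  assumes "tuple_dominating k G S"
    and "\<And>x. x \<in> verts G - S \<Longrightarrow>
           \<exists>T \<subseteq> verts G. T \<inter> S = {} \<and> k \<le> card (open_nbhd G x \<inter> T)"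
  shows "tuple_restrained_dominating k G S"
  unfolding tuple_restrained_dominating_def
proof (intro conjI ballI)
  fix x assume "x \<in> verts G - S"
  then obtain T where T: "T \<subseteq> verts G" "T \<inter> S = {}" "k \<le> card (open_nbhd G x \<inter> T)"
    using assms(2) by blast
  have "card (open_nbhd G x \<inter> T) \<le> card (open_nbhd G x \<inter> (verts G - S))"
    using T by (intro card_mono) (auto simp: finite_open_nbhd)
  then show "k \<le> card (open_nbhd G x \<inter> (verts G - S))"
    using T(3) by linarith
qed (rule assms(1))

lemma partition_dominating_restrained:
  assumes part: "partition_on (verts G) \<C>"
    and dom: "\<And>T. T \<in> \<C> \<Longrightarrow> tuple_dominating k G T"
    and card: "card \<C> \<noteq> 2" and S: "S \<in> \<C>"
  shows "tuple_restrained_dominating k G S"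
proof (rule tuple_restrained_dominatingI)
  fix x assume x: "x \<in> verts G - S"
  then obtain X where X: "X \<in> \<C>" "x \<in> X" "X \<noteq> S"
    using part by (auto simp: partition_on_def)
  \<comment> \<open>\<open>S\<close> and \<open>X\<close> are two distinct classes, so a number of
    classes other than 2 forces a third one. A single class cannot occur here, because
    \<open>x\<close> lies outside \<open>S\<close>.\<close>
  have "\<C> \<noteq> {S, X}" using card X(3) by (metis card_2_iff)
  then obtain T where T: "T \<in> \<C>" "T \<noteq> S" "T \<noteq> X" using S X(1) by blast
  \<comment> \<open>As \<open>x\<close> is not in \<open>T\<close>, domination of \<open>x\<close>
    by \<open>T\<close> comes from genuine neighbours only.\<close>
  have "x \<notin> T" and disj: "T \<inter> S = {}"
    using partition_onD2[OF part] T X S by (auto simp: disjoint_def)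
  then have "closed_nbhd G x \<inter> T = open_nbhd G x \<inter> T"
    by (auto simp: closed_nbhd_def)
  then have "k \<le> card (open_nbhd G x \<inter> T)" "T \<subseteq> verts G"
    using dom[OF T(1)] x by (auto simp: tuple_dominating_def)
  then show "\<exists>T \<subseteq> verts G. T \<inter> S = {} \<and> k \<le> card (open_nbhd G x \<inter> T)"
    using disj by blast
qed (rule dom[OF S])

lemma partition_total_dominating_restrained:
  assumes part: "partition_on (verts G) \<C>"
    and dom: "\<And>T. T \<in> \<C> \<Longrightarrow> tuple_total_dominating k G T"
    and S: "S \<in> \<C>"
  shows "tuple_restrained_dominating k G S"
proof (rule tuple_restrained_dominatingI)
  fix x assume x: "x \<in> verts G - S"
  then obtain X where X: "X \<in> \<C>" "x \<in> X" "X \<noteq> S"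
    using part by (auto simp: partition_on_def)
  have "X \<inter> S = {}"
    using partition_onD2[OF part] X S by (auto simp: disjoint_def)
  \<comment> \<open>Take \<open>T = X\<close>: although \<open>x\<close> is in \<open>X\<close>,
    total domination does not count \<open>x\<close> itself.\<close>
  then show "\<exists>T \<subseteq> verts G. T \<inter> S = {} \<and> k \<le> card (open_nbhd G x \<inter> T)"
    using dom[OF X(1)] x by (auto simp: tuple_total_dominating_def)
qed (rule tuple_total_dominating_imp_dominating[OF dom[OF S]])

lemma tuple_restrained_domatic_number_le:
  assumes "min_degree G \<ge> k - 1"
  shows "tuple_restrained_domatic_number k G \<le> tuple_domatic_number k G"
  unfolding tuple_restrained_domatic_number_def tuple_domatic_number_def
  by (rule max_partition_size_mono)
    (use tuple_restrained_dominating_verts[OF assms] in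
      \<open>auto simp: tuple_restrained_dominating_def\<close>)

text \<open>An optimal partition into total dominating sets is, unchanged, a partition into
  restrained dominating sets.\<close>

lemma tuple_total_domatic_number_le_restrained:
  assumes "min_degree G \<ge> k"
  shows "tuple_total_domatic_number k G \<le> tuple_restrained_domatic_number k G"
proof -
  obtain \<C> where \<C>: "partition_on (verts G) \<C>"
    "\<And>S. S \<in> \<C> \<Longrightarrow> tuple_total_dominating k G S"
    "card \<C> = tuple_total_domatic_number k G"
    unfolding tuple_total_domatic_number_def
    by (rule max_partition_size_attained[of _ "tuple_total_dominating k G",
          OF finite_verts tuple_total_dominating_verts[OF assms]]) blast
  have "card \<C> \<le> tuple_restrained_domatic_number k G"
    unfolding tuple_restrained_domatic_number_def
  proof (rule card_le_max_partition_size[OF finite_verts \<C>(1)])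
    show "tuple_restrained_dominating k G S" if "S \<in> \<C>" for S
      by (rule partition_total_dominating_restrained[OF \<C>(1) _ that]) (rule \<C>(2))
  qed
  then show ?thesis
    using \<C>(3) by simp
qed

text \<open>The partition \<open>{verts G}\<close> is the witness; without vertices the only
  partition is empty and has size 0.\<close>

lemma tuple_total_domatic_number_pos:
  assumes "min_degree G \<ge> k" "verts G \<noteq> {}"
  shows "tuple_total_domatic_number k G \<ge> 1"
  using card_le_max_partition_size[OF finite_verts partition_on_space[OF assms(2)],
      of "tuple_total_dominating k G"] tuple_total_dominating_verts[OF assms(1)]
  by (simp add: tuple_total_domatic_number_def)

end

theorem theorem4p5:
  fixes G :: "('a, 'b) pre_digraph" and k :: nat
  assumes "graph G"
    and "k \<ge> 1"
    and "min_degree G \<ge> k - 1"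
    and "tuple_domatic_number k G \<noteq> 2 \<or>
         (min_degree G \<ge> k \<and> tuple_total_domatic_number k G \<noteq> 1)"
  shows "tuple_restrained_domatic_number k G = tuple_domatic_number k G"
proof (rule antisym)
  interpret graph G by fact
  show "tuple_restrained_domatic_number k G \<le> tuple_domatic_number k G"
    using assms(3) by (rule tuple_restrained_domatic_number_le)
  obtain \<C> where \<C>: "partition_on (verts G) \<C>" "\<And>S. S \<in> \<C> \<Longrightarrow> tuple_dominating k G S"
    "card \<C> = tuple_domatic_number k G"
    unfolding tuple_domatic_number_def
    by (rule max_partition_size_attained[of _ "tuple_dominating k G",
          OF finite_verts tuple_dominating_verts[OF assms(3)]]) blast
  show "tuple_domatic_number k G \<le> tuple_restrained_domatic_number k G"
  proof (cases "tuple_domatic_number k G = 2")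
    case True
    then have deg: "min_degree G \<ge> k" and "tuple_total_domatic_number k G \<noteq> 1"
      using assms(4) by auto
    \<comment> \<open>An empty vertex set would leave only the empty partition, of size 0 instead of
      2.\<close>
    moreover have "verts G \<noteq> {}"
      using True \<C>(1,3) by (auto simp: partition_on_empty)
    \<comment> \<open>Positive and different from 1. The two classes needed now come from an optimal
      total partition, not from \<open>\<C>\<close>.\<close>
    ultimately have "2 \<le> tuple_total_domatic_number k G"
      using tuple_total_domatic_number_pos by fastforce
    then show ?thesis
      using True tuple_total_domatic_number_le_restrained[OF deg] by linarith
  next
    case False
    \<comment> \<open>Here the optimal partition \<open>\<C>\<close> itself has only restrained
      dominating classes.\<close>
    then have ne2: "card \<C> \<noteq> 2" using \<C>(3) by simp
    have "card \<C> \<le> tuple_restrained_domatic_number k G"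
      unfolding tuple_restrained_domatic_number_def
    proof (rule card_le_max_partition_size[OF finite_verts \<C>(1)])
      show "tuple_restrained_dominating k G S" if "S \<in> \<C>" for S
        by (rule partition_dominating_restrained[OF \<C>(1) _ ne2 that]) (rule \<C>(2))
    qed
    then show ?thesis using \<C>(3) by simp
  qed
qed

end
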